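(* Let $(M^{2n+1},\varphi,Q,\xi,\eta,g)$ be a weak almost contact B-metric manifold with contact distribution $\mathcal{D}=\operatorname{Ker}\eta$, and let $\nabla$ be the Levi-Civita connection of $g$. Then: (i) $\eta = g(\cdot,\xi)$; (ii) $TM=\mathcal{D}\perp \mathrm{Span}\{\xi\}$ (the direct sum is $g$-orthogonal), and the restrictions of $g$ to both distributions $\mathcal{D}$ and $\mathrm{Span}\{\xi\}$ are nondegenerate; (iii) $\nabla_X\xi$ is orthogonal to $\xi$, i.e. $\nabla_X\xi\in\Gamma(\mathcal{D})$ for all $X\in\chi(M)$; (iv) $\varphi$ and $Q$ are symmetric with respect to $g$, i.e. $g(\varphi X,Y)=g(X,\varphi Y)$ and $g(QX,Y)=g(X,QY)$ for all $X,Y\in\chi(M)$; (v) the $(0,2)$-tensor field $G$ defined by $G(X,Y)=g(X,\varphi Y)$, $X,Y\in\chi(M)$, is symmetric on $M$, and its restriction to $\mathcal{D}$ is nondegenerate; (vi) the $(1,1)$-tensor fields $\varphi$ and $Q$ commute, i.e. $\varphi\circ Q=Q\circ\varphi$.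
   Context: $\chi(M)$ denotes the smooth vector fields on $M$ and $\Gamma(\mathcal{D})$ the smooth sections of a distribution $\mathcal{D}$. A smooth manifold $M^{2n+1}$ ($n\ge 1$) carries a weak almost contact structure $(\varphi,Q,\xi,\eta)$ if it admits a $(1,1)$-tensor field $\varphi$, a nonsingular $(1,1)$-tensor field $Q$, a vector field $\xi$ and a 1-form $\eta$ such that $\varphi^2=-Q+\eta\otimes\xi$, $\eta(\xi)=1$, $Q\xi=\xi$, and $\mathcal{D}:=\operatorname{Ker}\eta$ (the contact distribution) is $\varphi$-invariant, i.e. $\varphi(\mathcal{D})\subset\mathcal{D}$. Here $(\eta\otimes\xi)(X)=\eta(X)\xi$. If moreover $g$ is a (semi-)Riemannian metric on $M$ (Riemannian or indefinite) with $g(\varphi X,\varphi Y)=-g(X,QY)+\eta(X)\eta(Y)$ for all $X,Y\in\chi(M)$, then $(M^{2n+1},\varphi,Q,\xi,\eta,g)$ is called a weak almost contact B-metric manifold. *)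

theory Defs
  imports "HOL-Analysis.Analysis" "HOL-Library.Function_Algebras"
begin

instantiation "fun" :: (type, real_vector) real_vector
begin

definition scaleR_fun :: "real \<Rightarrow> ('a \<Rightarrow> 'b) \<Rightarrow> 'a \<Rightarrow> 'b"
  where "scaleR_fun r f = (\<lambda>x. r *\<^sub>R f x)"

instance
  by standard (auto simp: scaleR_fun_def fun_eq_iff scaleR_add_right scaleR_add_left)

end


subsection \<open>Smooth maps between open subsets of normed spaces\<close>

primrec Ck_on :: "nat \<Rightarrow> 'a::real_normed_vector set \<Rightarrow> ('a \<Rightarrow> 'b::real_normed_vector) \<Rightarrow> bool"
where
  "Ck_on 0 S f \<longleftrightarrow> continuous_on S f"
| "Ck_on (Suc k) S f \<longleftrightarrow> (\<forall>x\<in>S. f differentiable (at x)) \<and>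
     (\<forall>v. Ck_on k S (\<lambda>x. frechet_derivative f (at x) v))"

text \<open>Derivatives are taken with \<open>at x\<close>, so this is meant for open \<open>S\<close> only.\<close>

definition smooth_on :: "'a::real_normed_vector set \<Rightarrow> ('a \<Rightarrow> 'b::real_normed_vector) \<Rightarrow> bool"
  where "smooth_on S f \<longleftrightarrow> (\<forall>k. Ck_on k S f)"


subsection \<open>Smooth manifolds\<close>

text \<open>
  The underlying space of a manifold is a whole Hausdorff, second countable type \<open>'a\<close>, and
  the model space is a Euclidean space \<open>'e\<close>, whose dimension is the dimension of the manifold.
  A chart is a pair of a domain and a coordinate map; values of the coordinate map
  outside the domain are irrelevant. The smooth structure is given by an atlas that need not
  be maximal.
\<close>

type_synonym ('a, 'e) chart = "'a set \<times> ('a \<Rightarrow> 'e)"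

definition chart_inv :: "('a, 'e) chart \<Rightarrow> 'e \<Rightarrow> 'a"
  where "chart_inv c = inv_into (fst c) (snd c)"

definition chart_image :: "('a, 'e) chart \<Rightarrow> 'e set"
  where "chart_image c = snd c ` fst c"

definition is_chart :: "('a::topological_space, 'e::euclidean_space) chart \<Rightarrow> bool"
  where "is_chart c \<longleftrightarrow> open (fst c) \<and> open (chart_image c) \<and>
     homeomorphism (fst c) (chart_image c) (snd c) (chart_inv c)"

definition smooth_manifold ::
    "('a::{t2_space,second_countable_topology}, 'e::euclidean_space) chart set \<Rightarrow> bool"
  where "smooth_manifold A \<longleftrightarrow>
     (\<forall>c\<in>A. is_chart c) \<and> (\<Union>c\<in>A. fst c) = UNIV \<and>
     (\<forall>c\<in>A. \<forall>c'\<in>A. smooth_on (snd c ` (fst c \<inter> fst c')) (snd c' \<circ> chart_inv c))"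

definition smooth_function :: "('a, 'e::euclidean_space) chart set \<Rightarrow> ('a \<Rightarrow> real) \<Rightarrow> bool"
  where "smooth_function A f \<longleftrightarrow> (\<forall>c\<in>A. smooth_on (chart_image c) (f \<circ> chart_inv c))"


subsection \<open>Tangent vectors and tensor fields\<close>

text \<open>
  A tangent vector at \<open>p\<close> is the family of its component vectors with respect to all charts of
  the atlas around \<open>p\<close>, related by the derivatives of the coordinate changes. The
  components at all other charts are set to \<open>0\<close>, so that equality of tangent vectors is equality
  of families.
\<close>

type_synonym ('a, 'e) tvec = "('a, 'e) chart \<Rightarrow> 'e"

definition tangent_space ::
    "('a, 'e::euclidean_space) chart set \<Rightarrow> 'a \<Rightarrow> ('a, 'e) tvec set"
  where "tangent_space A p = {v.
     (\<forall>c. c \<notin> A \<or> p \<notin> fst c \<longrightarrow> v c = 0) \<and>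
     (\<forall>c\<in>A. \<forall>c'\<in>A. p \<in> fst c \<and> p \<in> fst c' \<longrightarrow>
        v c' = frechet_derivative (snd c' \<circ> chart_inv c) (at (snd c p)) (v c))}"

text \<open>The tangent vector at \<open>p\<close> whose component vector in the chart \<open>c\<close> is \<open>e\<close>.\<close>

definition coord_vec ::
    "('a, 'e::euclidean_space) chart set \<Rightarrow> ('a, 'e) chart \<Rightarrow> 'a \<Rightarrow> 'e \<Rightarrow> ('a, 'e) tvec"
  where "coord_vec A c p e = (\<lambda>c'.
     if c' \<in> A \<and> p \<in> fst c'
     then frechet_derivative (snd c' \<circ> chart_inv c) (at (snd c p)) e else 0)"

type_synonym ('a, 'e) vfield = "'a \<Rightarrow> ('a, 'e) tvec"

definition vector_fields :: "('a, 'e::euclidean_space) chart set \<Rightarrow> ('a, 'e) vfield set"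
  where "vector_fields A = {X.
     (\<forall>p. X p \<in> tangent_space A p) \<and>
     (\<forall>c\<in>A. smooth_on (chart_image c) (\<lambda>x. X (chart_inv c x) c))}"

definition linear_on_subspace ::
    "'v::real_vector set \<Rightarrow> ('v \<Rightarrow> 'w::real_vector) \<Rightarrow> bool"
  where "linear_on_subspace V f \<longleftrightarrow>
     (\<forall>u\<in>V. \<forall>v\<in>V. f (u + v) = f u + f v) \<and> (\<forall>r. \<forall>u\<in>V. f (r *\<^sub>R u) = r *\<^sub>R f u)"

text \<open>
  Tensor fields are families of linear or bilinear maps on the tangent spaces whose components in
  every chart are smooth functions of the coordinates. Their values off the tangent spaces are
  irrelevant.
\<close>

definition one_form ::
    "('a, 'e::euclidean_space) chart set \<Rightarrow> ('a \<Rightarrow> ('a, 'e) tvec \<Rightarrow> real) \<Rightarrow> bool"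
  where "one_form A \<eta> \<longleftrightarrow>
     (\<forall>p. linear_on_subspace (tangent_space A p) (\<eta> p)) \<and>
     (\<forall>c\<in>A. \<forall>e. smooth_on (chart_image c)
        (\<lambda>x. \<eta> (chart_inv c x) (coord_vec A c (chart_inv c x) e)))"

definition tensor_11 ::
    "('a, 'e::euclidean_space) chart set \<Rightarrow> ('a \<Rightarrow> ('a, 'e) tvec \<Rightarrow> ('a, 'e) tvec) \<Rightarrow> bool"
  where "tensor_11 A T \<longleftrightarrow>
     (\<forall>p. T p ` tangent_space A p \<subseteq> tangent_space A p \<and>
          linear_on_subspace (tangent_space A p) (T p)) \<and>
     (\<forall>c\<in>A. \<forall>e. smooth_on (chart_image c)
        (\<lambda>x. T (chart_inv c x) (coord_vec A c (chart_inv c x) e) c))"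

definition tensor_02 ::
    "('a, 'e::euclidean_space) chart set \<Rightarrow>
     ('a \<Rightarrow> ('a, 'e) tvec \<Rightarrow> ('a, 'e) tvec \<Rightarrow> real) \<Rightarrow> bool"
  where "tensor_02 A B \<longleftrightarrow>
     (\<forall>p. \<forall>u\<in>tangent_space A p.
        linear_on_subspace (tangent_space A p) (\<lambda>v. B p u v) \<and>
        linear_on_subspace (tangent_space A p) (\<lambda>v. B p v u)) \<and>
     (\<forall>c\<in>A. \<forall>e e'. smooth_on (chart_image c)
        (\<lambda>x. B (chart_inv c x) (coord_vec A c (chart_inv c x) e)
                (coord_vec A c (chart_inv c x) e')))"

definition nondegenerate_on :: "'v::real_vector set \<Rightarrow> ('v \<Rightarrow> 'v \<Rightarrow> real) \<Rightarrow> bool"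
  where "nondegenerate_on V b \<longleftrightarrow> (\<forall>u\<in>V. (\<forall>v\<in>V. b u v = 0) \<longrightarrow> u = 0)"

definition symmetric_on :: "'v set \<Rightarrow> ('v \<Rightarrow> 'v \<Rightarrow> real) \<Rightarrow> bool"
  where "symmetric_on V b \<longleftrightarrow> (\<forall>u\<in>V. \<forall>v\<in>V. b u v = b v u)"

text \<open>The largest dimension of a subspace of \<open>V\<close> on which \<open>b\<close> is negative definite.\<close>

definition form_index :: "'v::real_vector set \<Rightarrow> ('v \<Rightarrow> 'v \<Rightarrow> real) \<Rightarrow> nat"
  where "form_index V b =
     Sup {dim W | W. subspace W \<and> W \<subseteq> V \<and> (\<forall>w\<in>W. w \<noteq> 0 \<longrightarrow> b w w < 0)}"

definition semi_riemannian_metric ::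
    "('a, 'e::euclidean_space) chart set \<Rightarrow>
     ('a \<Rightarrow> ('a, 'e) tvec \<Rightarrow> ('a, 'e) tvec \<Rightarrow> real) \<Rightarrow> bool"
  where "semi_riemannian_metric A g \<longleftrightarrow> tensor_02 A g \<and>
     (\<forall>p. symmetric_on (tangent_space A p) (g p) \<and>
          nondegenerate_on (tangent_space A p) (g p)) \<and>
     (\<exists>\<nu>. \<forall>p. form_index (tangent_space A p) (g p) = \<nu>)"


subsection \<open>The Levi-Civita connection\<close>

text \<open>The function \<open>X f\<close>; the value does not depend on the chosen chart around \<open>p\<close>.\<close>

definition vf_apply ::
    "('a, 'e::euclidean_space) chart set \<Rightarrow> ('a, 'e) vfield \<Rightarrow> ('a \<Rightarrow> real) \<Rightarrow> 'a \<Rightarrow> real"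
  where "vf_apply A X f p =
     (let c = (SOME c. c \<in> A \<and> p \<in> fst c)
      in frechet_derivative (f \<circ> chart_inv c) (at (snd c p)) (X p c))"

definition lie_bracket ::
    "('a, 'e::euclidean_space) chart set \<Rightarrow> ('a, 'e) vfield \<Rightarrow> ('a, 'e) vfield \<Rightarrow> ('a, 'e) vfield"
  where "lie_bracket A X Y p = (\<lambda>c.
     if c \<in> A \<and> p \<in> fst c
     then frechet_derivative (\<lambda>x. Y (chart_inv c x) c) (at (snd c p)) (X p c) -
          frechet_derivative (\<lambda>x. X (chart_inv c x) c) (at (snd c p)) (Y p c)
     else 0)"

definition affine_connection ::
    "('a, 'e::euclidean_space) chart set \<Rightarrow>
     (('a, 'e) vfield \<Rightarrow> ('a, 'e) vfield \<Rightarrow> ('a, 'e) vfield) \<Rightarrow> bool"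
  where "affine_connection A nabla \<longleftrightarrow>
     (\<forall>X\<in>vector_fields A. \<forall>Y\<in>vector_fields A.
        nabla X Y \<in> vector_fields A \<and>
        (\<forall>Z\<in>vector_fields A.
           nabla (X + Z) Y = nabla X Y + nabla Z Y \<and>
           nabla X (Y + Z) = nabla X Y + nabla X Z) \<and>
        (\<forall>f. smooth_function A f \<longrightarrow>
           nabla (\<lambda>p. f p *\<^sub>R X p) Y = (\<lambda>p. f p *\<^sub>R nabla X Y p) \<and>
           nabla X (\<lambda>p. f p *\<^sub>R Y p) = (\<lambda>p. vf_apply A X f p *\<^sub>R Y p + f p *\<^sub>R nabla X Y p)))"

definition levi_civita_connection ::
    "('a, 'e::euclidean_space) chart set \<Rightarrow>
     ('a \<Rightarrow> ('a, 'e) tvec \<Rightarrow> ('a, 'e) tvec \<Rightarrow> real) \<Rightarrow>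
     (('a, 'e) vfield \<Rightarrow> ('a, 'e) vfield \<Rightarrow> ('a, 'e) vfield) \<Rightarrow> bool"
  where "levi_civita_connection A g nabla \<longleftrightarrow> affine_connection A nabla \<and>
     (\<forall>X\<in>vector_fields A. \<forall>Y\<in>vector_fields A.
        nabla X Y - nabla Y X = lie_bracket A X Y) \<and>
     (\<forall>X\<in>vector_fields A. \<forall>Y\<in>vector_fields A. \<forall>Z\<in>vector_fields A. \<forall>p.
        vf_apply A X (\<lambda>q. g q (Y q) (Z q)) p =
          g p (nabla X Y p) (Z p) + g p (Y p) (nabla X Z p))"


subsection \<open>Weak almost contact B-metric structures\<close>

definition contact_distribution ::
    "('a, 'e::euclidean_space) chart set \<Rightarrow> ('a \<Rightarrow> ('a, 'e) tvec \<Rightarrow> real) \<Rightarrow>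
     'a \<Rightarrow> ('a, 'e) tvec set"
  where "contact_distribution A \<eta> p = {v \<in> tangent_space A p. \<eta> p v = 0}"

definition smooth_sections ::
    "('a, 'e::euclidean_space) chart set \<Rightarrow> ('a \<Rightarrow> ('a, 'e) tvec set) \<Rightarrow> ('a, 'e) vfield set"
  where "smooth_sections A D = {X \<in> vector_fields A. \<forall>p. X p \<in> D p}"

definition weak_almost_contact ::
    "('a, 'e::euclidean_space) chart set \<Rightarrow>
     ('a \<Rightarrow> ('a, 'e) tvec \<Rightarrow> ('a, 'e) tvec) \<Rightarrow> ('a \<Rightarrow> ('a, 'e) tvec \<Rightarrow> ('a, 'e) tvec) \<Rightarrow>
     ('a, 'e) vfield \<Rightarrow> ('a \<Rightarrow> ('a, 'e) tvec \<Rightarrow> real) \<Rightarrow> bool"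
  where "weak_almost_contact A \<phi> Q \<xi> \<eta> \<longleftrightarrow>
     tensor_11 A \<phi> \<and> tensor_11 A Q \<and> \<xi> \<in> vector_fields A \<and> one_form A \<eta> \<and>
     (\<forall>p. bij_betw (Q p) (tangent_space A p) (tangent_space A p)) \<and>
     (\<forall>p. \<forall>v\<in>tangent_space A p. \<phi> p (\<phi> p v) = - Q p v + \<eta> p v *\<^sub>R \<xi> p) \<and>
     (\<forall>p. \<eta> p (\<xi> p) = 1) \<and>
     (\<forall>p. Q p (\<xi> p) = \<xi> p) \<and>
     (\<forall>p. \<phi> p ` contact_distribution A \<eta> p \<subseteq> contact_distribution A \<eta> p)"

definition weak_almost_contact_B_metric ::
    "('a, 'e::euclidean_space) chart set \<Rightarrow>
     ('a \<Rightarrow> ('a, 'e) tvec \<Rightarrow> ('a, 'e) tvec) \<Rightarrow> ('a \<Rightarrow> ('a, 'e) tvec \<Rightarrow> ('a, 'e) tvec) \<Rightarrow>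
     ('a, 'e) vfield \<Rightarrow> ('a \<Rightarrow> ('a, 'e) tvec \<Rightarrow> real) \<Rightarrow>
     ('a \<Rightarrow> ('a, 'e) tvec \<Rightarrow> ('a, 'e) tvec \<Rightarrow> real) \<Rightarrow> bool"
  where "weak_almost_contact_B_metric A \<phi> Q \<xi> \<eta> g \<longleftrightarrow>
     weak_almost_contact A \<phi> Q \<xi> \<eta> \<and> semi_riemannian_metric A g \<and>
     (\<forall>X\<in>vector_fields A. \<forall>Y\<in>vector_fields A. \<forall>p.
        g p (\<phi> p (X p)) (\<phi> p (Y p)) = - g p (X p) (Q p (Y p)) + \<eta> p (X p) * \<eta> p (Y p))"

end

theory Submission
  imports Defs
begin

text \<open>
  Once compatibility is known for single tangent vectors, everything except the statement on
  \<open>\<nabla>\<xi>\<close> and the smoothness of \<open>G\<close> is linear algebra in one tangent space. Writing \<open>\<phi> \<xi>\<close> as a multiple of \<open>\<xi>\<close> plus a vector of the invariant subspace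
  \<open>Ker \<eta>\<close> and using \<open>\<phi> (\<phi> \<xi>) = - Q \<xi> + \<xi> = 0\<close> forces \<open>\<phi> \<xi> = 0\<close> (lemma \<open>\<phi>_\<xi>\<close>), because \<open>\<phi>\<^sup>2 = - Q\<close>
  is injective on \<open>Ker \<eta>\<close>; hence \<open>\<eta> \<circ> \<phi> = 0\<close>. Compatibility with \<open>\<xi>\<close> in one argument then reads
  \<open>\<eta> = g(\<cdot>,\<xi>)\<close>, which makes the splitting orthogonal and the restrictions nondegenerate.
  Computing \<open>\<phi>\<^sup>3\<close> in two ways shows that \<open>\<phi>\<close> and \<open>Q\<close> commute. \<open>Q\<close> is self-adjoint since the
  remaining terms of the compatibility condition are symmetric, and compatibility for the pair
  \<open>u\<close>, \<open>\<phi> v\<close> gives \<open>g(\<phi> u, Q v) = g(u, \<phi> (Q v))\<close>, so that \<open>\<phi>\<close> is self-adjoint because \<open>Q\<close> is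
  onto. Nondegeneracy of \<open>G\<close> on \<open>Ker \<eta>\<close> follows from that of \<open>g\<close> and the injectivity of \<open>\<phi>\<close> there.

  The analytic content lies in passing from vector fields to tangent vectors: compatibility is a
  condition on global smooth fields, so each tangent vector must be the value of one
  (\<open>tangent_vector_extends\<close>). This needs a smooth bump function (\<open>smooth_bump_exists\<close>) and the
  closure of smooth maps under sums, products and composition.
  Finally \<open>g(\<xi>,\<xi>) = 1\<close> is constant, so the metric property of the connection gives
  \<open>2 g(\<nabla>\<^sub>X \<xi>, \<xi>) = 0\<close> (\<open>levi_civita_constant_length\<close>).
\<close>

section \<open>Calculus of continuously differentiable maps\<close>

lemma Ck_on_cong:
  assumes "open S" "\<And>x. x \<in> S \<Longrightarrow> f x = g x"
  shows "Ck_on k S f \<longleftrightarrow> Ck_on k S g"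
  using assms(2)
proof (induction k arbitrary: f g)
  case 0
  then show ?case by (simp cong: continuous_on_cong)
next
  case (Suc k)
  have deriv_iff: "(f has_derivative D) (at x) \<longleftrightarrow> (g has_derivative D) (at x)"
    if "x \<in> S" for x D
    using has_derivative_transform_within_open[OF _ assms(1) that] Suc.prems by metis
  have "f differentiable (at x) \<longleftrightarrow> g differentiable (at x)"
      "frechet_derivative f (at x) = frechet_derivative g (at x)" if "x \<in> S" for x
    using deriv_iff[OF that] by (simp_all add: differentiable_def frechet_derivative_def)
  then show ?case
    using Suc.IH[of "\<lambda>x. frechet_derivative f (at x) v" "\<lambda>x. frechet_derivative g (at x) v" for v]
    by simp
qed

text \<open>The directional derivatives of a map are seldom computed as literally the Frechet derivative.
  This rule lets a proof supply them by a formula.\<close>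

lemma Ck_on_SucI:
  assumes "open S" "\<And>x. x \<in> S \<Longrightarrow> (f has_derivative f' x) (at x)"
    "\<And>v. Ck_on k S (\<lambda>x. f' x v)"
  shows "Ck_on (Suc k) S f"
proof -
  have "Ck_on k S (\<lambda>x. frechet_derivative f (at x) v)" for v
    using Ck_on_cong[OF assms(1), of "\<lambda>x. frechet_derivative f (at x) v" "\<lambda>x. f' x v"]
      assms(3) frechet_derivative_at[OF assms(2)] by metis
  then show ?thesis using assms(2) by (auto simp: differentiable_def)
qed

lemma Ck_on_SucD:
  assumes "Ck_on (Suc k) S f" "x \<in> S"
  shows "(f has_derivative frechet_derivative f (at x)) (at x)"
  using assms by (simp add: frechet_derivative_works)

lemma Ck_on_Suc_imp: "Ck_on (Suc k) S f \<Longrightarrow> Ck_on k S f"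
proof (induction k arbitrary: f)
  case 0
  then show ?case
    by (auto intro!: continuous_at_imp_continuous_on differentiable_imp_continuous_within)
next
  case (Suc k)
  then have "Ck_on (Suc k) S (\<lambda>x. frechet_derivative f (at x) v)" for v
    by (subst (asm) Ck_on.simps(2)) blast
  with Suc show ?case
    by (subst Ck_on.simps(2)) (metis Ck_on.simps(2))
qed

lemma Ck_on_const: "Ck_on k S (\<lambda>x. c)"
  by (induction k arbitrary: c) (auto simp: frechet_derivative_const)

lemma Ck_on_add:
  assumes "open S" "Ck_on k S f" "Ck_on k S g"
  shows "Ck_on k S (\<lambda>x. f x + g x)"
  using assms(2,3)
proof (induction k arbitrary: f g)
  case 0
  then show ?case by (auto intro: continuous_intros)
next
  case (Suc k)
  show ?case
    by (rule Ck_on_SucI[OF assms(1) has_derivative_add[OF Ck_on_SucD Ck_on_SucD]])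
       (use Suc in auto)
qed

lemma Ck_on_sum:
  assumes "open S" "\<And>i. i \<in> I \<Longrightarrow> Ck_on k S (f i)"
  shows "Ck_on k S (\<lambda>x. \<Sum>i\<in>I. f i x)"
  using assms(2)
  by (induction I rule: infinite_finite_induct) (auto intro: Ck_on_const Ck_on_add[OF assms(1)])

lemma Ck_on_bilinear:
  assumes "bounded_bilinear B" "open S" "Ck_on k S f" "Ck_on k S g"
  shows "Ck_on k S (\<lambda>x. B (f x) (g x))"
  using assms(3,4)
proof (induction k arbitrary: f g)
  case 0
  then show ?case by (auto intro: bounded_bilinear.continuous_on[OF assms(1)])
next
  case (Suc k)
  show ?case
  proof (rule Ck_on_SucI[OF assms(2) bounded_bilinear.FDERIV[OF assms(1) Ck_on_SucD Ck_on_SucD]])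
    fix v
    have "Ck_on k S (\<lambda>x. frechet_derivative f (at x) v)"
        "Ck_on k S (\<lambda>x. frechet_derivative g (at x) v)"
      using Suc.prems by auto
    then show "Ck_on k S (\<lambda>x. B (f x) (frechet_derivative g (at x) v) +
        B (frechet_derivative f (at x) v) (g x))"
      using Suc.prems[THEN Ck_on_Suc_imp] by (intro Ck_on_add[OF assms(2)] Suc.IH)
  qed (use Suc.prems in auto)
qed

lemma Ck_on_ident: "Ck_on k S (\<lambda>x. x)"
  by (cases k) (auto simp: frechet_derivative_ident Ck_on_const intro: continuous_intros)

lemma Ck_on_compose:
  fixes f :: "'c::real_normed_vector \<Rightarrow> 'e::euclidean_space"
  assumes "open S" "open T" "f ` S \<subseteq> T" "Ck_on k S f" "Ck_on k T g"
  shows "Ck_on k S (\<lambda>x. g (f x))"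
  using assms(4,5)
proof (induction k arbitrary: g)
  case 0
  then show ?case using assms(3) by (auto intro: continuous_on_compose2)
next
  case (Suc k)
  let ?Df = "\<lambda>x. frechet_derivative f (at x)" and ?Dg = "\<lambda>y. frechet_derivative g (at y)"
  have Dg: "(g has_derivative ?Dg (f x)) (at (f x))" if "x \<in> S" for x
    using that assms(3) Suc.prems(2) by (intro Ck_on_SucD) auto
  show ?case
  proof (rule Ck_on_SucI[OF assms(1)])
    fix x assume x: "x \<in> S"
    interpret lin: bounded_linear "?Dg (f x)"
      using Dg[OF x] by (rule has_derivative_bounded_linear)
    \<comment> \<open>Expanding the inner derivative in an orthonormal basis separates the two factors of the
        chain rule, so that the derivative is a sum of products of maps of class k.\<close>
    have "(\<lambda>v. \<Sum>b\<in>Basis. (?Df x v \<bullet> b) *\<^sub>R ?Dg (f x) b) = (\<lambda>v. ?Dg (f x) (?Df x v))"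
      by (rule ext, subst (2) euclidean_representation[symmetric]) (simp add: lin.sum lin.scaleR)
    then show "((\<lambda>x. g (f x)) has_derivative
        (\<lambda>v. \<Sum>b\<in>Basis. (?Df x v \<bullet> b) *\<^sub>R ?Dg (f x) b)) (at x)"
      using has_derivative_compose[OF Ck_on_SucD[OF Suc.prems(1) x] Dg[OF x]] by simp
  next
    fix v
    have "Ck_on k S (\<lambda>x. ?Df x v \<bullet> b)" for b
      using Suc.prems(1) by (intro Ck_on_bilinear[OF bounded_bilinear_inner assms(1)])
        (auto intro: Ck_on_const)
    moreover have "Ck_on k S (\<lambda>x. ?Dg (f x) b)" for b
      using Suc.prems by (intro Suc.IH Ck_on_Suc_imp[OF Suc.prems(1)]) auto
    ultimately show "Ck_on k S (\<lambda>x. \<Sum>b\<in>Basis. (?Df x v \<bullet> b) *\<^sub>R ?Dg (f x) b)"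
      by (intro Ck_on_sum[OF assms(1)] Ck_on_bilinear[OF bounded_bilinear_scaleR assms(1)])
  qed
qed

lemma Ck_on_subset: "Ck_on k S f \<Longrightarrow> T \<subseteq> S \<Longrightarrow> Ck_on k T f"
  by (induction k arbitrary: f) (auto intro: continuous_on_subset)

lemma Ck_on_Un:
  assumes "open S" "open T" "Ck_on k S f" "Ck_on k T f"
  shows "Ck_on k (S \<union> T) f"
  using assms(3,4)
  by (induction k arbitrary: f) (auto intro: continuous_on_open_Un assms(1,2))

section \<open>A smooth bump function\<close>

text \<open>For the polynomial 1 this is the classical smooth function that vanishes exactly on the
  nonpositive half-line. Allowing a polynomial factor in \<open>1 / t\<close> makes the family closed under
  differentiation, which is what turns smoothness into an induction.\<close>

definition flat_fun :: "real poly \<Rightarrow> real \<Rightarrow> real"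
  where "flat_fun P t = (if t > 0 then poly P (1 / t) * exp (- (1 / t)) else 0)"

lemma tendsto_poly_exp: "((\<lambda>s::real. poly P s * exp (- s)) \<longlongrightarrow> 0) at_top"
proof -
  have "((\<lambda>s. \<Sum>i\<le>degree P. coeff P i * (s ^ i / exp s)) \<longlongrightarrow> (\<Sum>i\<le>degree P. coeff P i * 0)) at_top"
    by (intro tendsto_intros tendsto_power_div_exp_0)
  then show ?thesis
    by (simp add: poly_altdef exp_minus field_simps sum_divide_distrib)
qed

lemma flat_fun_tendsto_0: "(flat_fun P \<longlongrightarrow> 0) (at 0)"
proof (rule filterlim_split_at_real)
  have "((\<lambda>t. poly P (inverse t) * exp (- inverse t)) \<longlongrightarrow> 0) (at_right 0)"
    by (rule filterlim_compose[OF tendsto_poly_exp filterlim_inverse_at_top_right])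
  then show "(flat_fun P \<longlongrightarrow> 0) (at_right 0)"
    by (rule Lim_transform_eventually)
       (auto simp: eventually_at_filter flat_fun_def inverse_eq_divide)
  show "(flat_fun P \<longlongrightarrow> 0) (at_left 0)"
    by (rule Lim_transform_eventually[OF tendsto_const])
       (auto simp: eventually_at_filter flat_fun_def)
qed

lemma flat_fun_has_derivative:
  "(flat_fun P has_real_derivative flat_fun ([:0, 0, 1:] * (P - pderiv P)) t) (at t)"
proof -
  consider "t > 0" | "t < 0" | "t = 0" by linarith
  then show ?thesis
  proof cases
    case 1
    have "((\<lambda>t. poly P (1 / t) * exp (- (1 / t))) has_real_derivative
        flat_fun ([:0, 0, 1:] * (P - pderiv P)) t) (at t)"
      using 1 by (auto intro!: derivative_eq_intros DERIV_chain2[OF poly_DERIV]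
          simp: flat_fun_def field_simps power2_eq_square)
    then show ?thesis
      by (rule has_field_derivative_transform_within_open[where S = "{0<..}"])
         (use 1 in \<open>auto simp: flat_fun_def\<close>)
  next
    case 2
    have "((\<lambda>t. 0) has_real_derivative 0) (at t)" by simp
    then have "(flat_fun P has_real_derivative 0) (at t)"
      by (rule has_field_derivative_transform_within_open[where S = "{..<0}"])
         (use 2 in \<open>auto simp: flat_fun_def\<close>)
    then show ?thesis using 2 by (simp add: flat_fun_def)
  next
    case 3
    \<comment> \<open>The difference quotient at 0 is itself a member of the family.\<close>
    have "(\<lambda>h. (flat_fun P (0 + h) - flat_fun P 0) / h) = flat_fun (pCons 0 P)"
      by (auto simp: flat_fun_def)
    then show ?thesis
      using 3 flat_fun_tendsto_0[of "pCons 0 P"] by (simp add: DERIV_def flat_fun_def)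
  qed
qed

lemma Ck_on_flat_fun: "Ck_on k UNIV (flat_fun P)"
proof (induction k arbitrary: P)
  case 0
  then show ?case
    using DERIV_isCont[OF flat_fun_has_derivative] by (simp add: continuous_at_imp_continuous_on)
next
  case (Suc k)
  show ?case
    by (rule Ck_on_SucI[OF open_UNIV flat_fun_has_derivative[unfolded has_field_derivative_def]])
       (intro Ck_on_bilinear[OF bounded_bilinear_mult open_UNIV] Suc.IH Ck_on_const)
qed

lemma smooth_bump_exists:
  fixes y :: "'e::euclidean_space"
  assumes "r > 0"
  obtains b :: "'e \<Rightarrow> real" where "smooth_on UNIV b" "b y = 1" "\<And>x. x \<notin> cball y r \<Longrightarrow> b x = 0"
proof
  let ?q = "\<lambda>x. r\<^sup>2 + - 1 * ((x + - y) \<bullet> (x + - y))"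
  let ?b = "\<lambda>x. flat_fun 1 (?q x) * (1 / flat_fun 1 (r\<^sup>2))"
  have "Ck_on k UNIV (\<lambda>x. x + - y)" for k
    by (intro Ck_on_add Ck_on_ident Ck_on_const) simp
  then have "Ck_on k UNIV ?q" for k
    by (intro Ck_on_add Ck_on_const Ck_on_bilinear[OF bounded_bilinear_inner]
        Ck_on_bilinear[OF bounded_bilinear_mult]) (auto simp: Ck_on_ident)
  then have "Ck_on k UNIV (\<lambda>x. flat_fun 1 (?q x))" for k
    by (intro Ck_on_compose[OF _ open_UNIV _ _ Ck_on_flat_fun]) auto
  then show "smooth_on UNIV ?b"
    unfolding smooth_on_def
    by (intro allI Ck_on_bilinear[OF bounded_bilinear_mult] Ck_on_const) auto
  show "?b y = 1" using assms by (simp add: flat_fun_def)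
  fix x assume "x \<notin> cball y r"
  then have "r < norm (x - y)" by (simp add: dist_norm norm_minus_commute)
  then have "r\<^sup>2 \<le> (norm (x - y))\<^sup>2" using assms by (intro power_mono) auto
  then show "?b x = 0" by (simp add: flat_fun_def power2_norm_eq_inner)
qed

section \<open>Tangent spaces\<close>

lemma linear_on_subspace_sum:
  assumes "subspace V" "linear_on_subspace V f" "\<And>i. w i \<in> V"
  shows "f (\<Sum>i\<in>I. r i *\<^sub>R w i) = (\<Sum>i\<in>I. r i *\<^sub>R f (w i))"
proof -
  have zero: "f 0 = 0"
    using assms(2) subspace_0[OF assms(1)] scaleR_zero_left unfolding linear_on_subspace_def by metis
  have scaled: "r i *\<^sub>R w i \<in> V" for i
    using assms(1,3) by (rule subspace_scale)
  show ?thesis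
  proof (induction I rule: infinite_finite_induct)
    case (insert i I)
    have "(\<Sum>i\<in>I. r i *\<^sub>R w i) \<in> V" using assms(1) scaled by (rule subspace_sum)
    then show ?case
      using insert assms(2,3) scaled by (simp add: linear_on_subspace_def)
  qed (simp_all add: zero)
qed

lemma chart_inv_chart: "p \<in> fst c \<Longrightarrow> is_chart c \<Longrightarrow> chart_inv c (snd c p) = p"
  and chart_inv_in: "x \<in> chart_image c \<Longrightarrow> is_chart c \<Longrightarrow> chart_inv c x \<in> fst c"
  and chart_chart_inv: "x \<in> chart_image c \<Longrightarrow> is_chart c \<Longrightarrow> snd c (chart_inv c x) = x"
  by (auto simp: is_chart_def homeomorphism_def)

lemma open_chart_image_subset:
  assumes "is_chart c" "open V"
  shows "open (snd c ` (fst c \<inter> V))"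
proof -
  have hom: "homeomorphism (fst c) (chart_image c) (snd c) (chart_inv c)"
    and "open (chart_image c)"
    using assms by (auto simp: is_chart_def)
  moreover have "openin (top_of_set (chart_image c)) (snd c ` (fst c \<inter> V))"
    using assms(2) by (intro homeomorphism_imp_open_map[OF hom]) blast
  ultimately show ?thesis by (meson openin_open_trans)
qed

context
  fixes A :: "('a::{t2_space,second_countable_topology}, 'e::euclidean_space) chart set"
  assumes manifold: "smooth_manifold A"
begin

lemma atlas_chart: "c \<in> A \<Longrightarrow> is_chart c"
  using manifold by (auto simp: smooth_manifold_def)

lemma atlas_cover: obtains c where "c \<in> A" "p \<in> fst c"
proof -
  have "p \<in> (\<Union>c\<in>A. fst c)" using manifold by (simp add: smooth_manifold_def)
  then show thesis using that by blast
qed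

lemma open_overlap:
  assumes "c \<in> A" "c' \<in> A"
  shows "open (snd c ` (fst c \<inter> fst c'))"
  using open_chart_image_subset assms atlas_chart by (metis is_chart_def)

lemma Ck_on_transition:
  assumes "c \<in> A" "c' \<in> A"
  shows "Ck_on k (snd c ` (fst c \<inter> fst c')) (snd c' \<circ> chart_inv c)"
  using manifold assms by (auto simp: smooth_manifold_def smooth_on_def)

lemma tangent_spaceI:
  assumes "\<And>c. c \<notin> A \<or> p \<notin> fst c \<Longrightarrow> v c = 0"
    and "\<And>c c'. c \<in> A \<Longrightarrow> c' \<in> A \<Longrightarrow> p \<in> fst c \<Longrightarrow> p \<in> fst c' \<Longrightarrow>
      v c' = frechet_derivative (snd c' \<circ> chart_inv c) (at (snd c p)) (v c)"
  shows "v \<in> tangent_space A p"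
  using assms unfolding tangent_space_def by blast

lemma tangent_space_0:
  assumes "v \<in> tangent_space A p" "c \<notin> A \<or> p \<notin> fst c"
  shows "v c = 0"
  using assms unfolding tangent_space_def by blast

lemma tangent_space_transition:
  assumes "v \<in> tangent_space A p" "c \<in> A" "c' \<in> A" "p \<in> fst c" "p \<in> fst c'"
  shows "v c' = frechet_derivative (snd c' \<circ> chart_inv c) (at (snd c p)) (v c)"
  using assms unfolding tangent_space_def by blast

lemma transition_has_derivative:
  assumes "c \<in> A" "c' \<in> A" "p \<in> fst c" "p \<in> fst c'"
  shows "((snd c' \<circ> chart_inv c) has_derivative
    frechet_derivative (snd c' \<circ> chart_inv c) (at (snd c p))) (at (snd c p))"
  using Ck_on_SucD[OF Ck_on_transition] assms by (metis IntI image_eqI)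

lemma linear_transition_derivative:
  assumes "c \<in> A" "c' \<in> A" "p \<in> fst c" "p \<in> fst c'"
  shows "linear (frechet_derivative (snd c' \<circ> chart_inv c) (at (snd c p)))"
  using transition_has_derivative[OF assms] by (rule has_derivative_linear)

lemma transition_derivative_chain:
  assumes "c \<in> A" "c' \<in> A" "c'' \<in> A" "p \<in> fst c" "p \<in> fst c'" "p \<in> fst c''"
  shows "frechet_derivative (snd c'' \<circ> chart_inv c) (at (snd c p)) e =
    frechet_derivative (snd c'' \<circ> chart_inv c') (at (snd c' p))
      (frechet_derivative (snd c' \<circ> chart_inv c) (at (snd c p)) e)"
proof -
  have eq: "(snd c' \<circ> chart_inv c) (snd c p) = snd c' p"
    using assms atlas_chart by (simp add: chart_inv_chart)
  have "(((snd c'' \<circ> chart_inv c') \<circ> (snd c' \<circ> chart_inv c)) has_derivative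
      (frechet_derivative (snd c'' \<circ> chart_inv c') (at (snd c' p)) \<circ>
        frechet_derivative (snd c' \<circ> chart_inv c) (at (snd c p)))) (at (snd c p))"
  proof (rule diff_chain_at)
    show "((snd c' \<circ> chart_inv c) has_derivative
        frechet_derivative (snd c' \<circ> chart_inv c) (at (snd c p))) (at (snd c p))"
      using assms by (intro transition_has_derivative)
    show "((snd c'' \<circ> chart_inv c') has_derivative
        frechet_derivative (snd c'' \<circ> chart_inv c') (at (snd c' p)))
        (at ((snd c' \<circ> chart_inv c) (snd c p)))"
      unfolding eq using assms by (intro transition_has_derivative)
  qed
  then have "((snd c'' \<circ> chart_inv c) has_derivative
      (frechet_derivative (snd c'' \<circ> chart_inv c') (at (snd c' p)) \<circ>
        frechet_derivative (snd c' \<circ> chart_inv c) (at (snd c p)))) (at (snd c p))"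
  proof (rule has_derivative_transform_within_open[OF _ open_overlap[OF assms(1,2)]])
    show "snd c p \<in> snd c ` (fst c \<inter> fst c')" using assms by blast
    fix x assume "x \<in> snd c ` (fst c \<inter> fst c')"
    then obtain q where q: "x = snd c q" "q \<in> fst c" "q \<in> fst c'" by blast
    then show "((snd c'' \<circ> chart_inv c') \<circ> (snd c' \<circ> chart_inv c)) x = (snd c'' \<circ> chart_inv c) x"
      using assms atlas_chart by (simp add: chart_inv_chart)
  qed
  from frechet_derivative_at[OF this] show ?thesis by (metis comp_apply)
qed

lemma coord_vec_same:
  assumes "c \<in> A" "p \<in> fst c"
  shows "coord_vec A c p e c = e"
proof -
  have "((snd c \<circ> chart_inv c) has_derivative (\<lambda>e. e)) (at (snd c p))"
    by (rule has_derivative_transform_within_open[OF has_derivative_ident open_overlap[of c c]])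
       (use assms atlas_chart[OF assms(1)] in \<open>auto simp: chart_inv_chart\<close>)
  from frechet_derivative_at[OF this] show ?thesis
    using assms by (simp add: coord_vec_def fun_eq_iff)
qed

lemma coord_vec_in_tangent_space:
  assumes "c \<in> A" "p \<in> fst c"
  shows "coord_vec A c p e \<in> tangent_space A p"
proof (rule tangent_spaceI)
  fix c' c'' assume "c' \<in> A" "c'' \<in> A" "p \<in> fst c'" "p \<in> fst c''"
  then show "coord_vec A c p e c'' =
      frechet_derivative (snd c'' \<circ> chart_inv c') (at (snd c' p)) (coord_vec A c p e c')"
    using transition_derivative_chain[of c c' c'' p e] assms by (simp add: coord_vec_def)
qed (auto simp: coord_vec_def)

lemma tangent_vector_eq_coord_vec:
  assumes "c \<in> A" "p \<in> fst c" "v \<in> tangent_space A p"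
  shows "v = coord_vec A c p (v c)"
proof
  fix c'
  show "v c' = coord_vec A c p (v c) c'"
    using tangent_space_0[OF assms(3), of c'] tangent_space_transition[OF assms(3,1) _ assms(2), of c']
    by (simp add: coord_vec_def)
qed

lemma coord_vec_sum:
  assumes "c \<in> A" "p \<in> fst c"
  shows "coord_vec A c p (\<Sum>i\<in>I. r i *\<^sub>R e i) = (\<Sum>i\<in>I. r i *\<^sub>R coord_vec A c p (e i))"
proof
  fix c'
  have "(\<Sum>i\<in>I. r i *\<^sub>R coord_vec A c p (e i)) c' = (\<Sum>i\<in>I. r i *\<^sub>R coord_vec A c p (e i) c')"
    by (induction I rule: infinite_finite_induct) (simp_all add: scaleR_fun_def)
  moreover have "coord_vec A c p (\<Sum>i\<in>I. r i *\<^sub>R e i) c' =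
      (\<Sum>i\<in>I. r i *\<^sub>R coord_vec A c p (e i) c')"
  proof (cases "c' \<in> A \<and> p \<in> fst c'")
    case True
    then interpret linear "frechet_derivative (snd c' \<circ> chart_inv c) (at (snd c p))"
      using linear_transition_derivative assms by blast
    show ?thesis using True by (simp add: coord_vec_def sum scale)
  next
    case False
    then show ?thesis unfolding coord_vec_def if_not_P[OF False] by simp
  qed
  ultimately show "coord_vec A c p (\<Sum>i\<in>I. r i *\<^sub>R e i) c' = (\<Sum>i\<in>I. r i *\<^sub>R coord_vec A c p (e i)) c'"
    by simp
qed

lemma subspace_tangent_space: "subspace (tangent_space A p)"
proof (rule subspaceI)
  show "0 \<in> tangent_space A p"
    by (rule tangent_spaceI) (simp_all add: linear_0 linear_transition_derivative)
next
  fix u v assume u: "u \<in> tangent_space A p" and v: "v \<in> tangent_space A p"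
  show "u + v \<in> tangent_space A p"
  proof (rule tangent_spaceI)
    fix c c' assume c: "c \<in> A" "c' \<in> A" "p \<in> fst c" "p \<in> fst c'"
    then show "(u + v) c' = frechet_derivative (snd c' \<circ> chart_inv c) (at (snd c p)) ((u + v) c)"
      using tangent_space_transition[OF u c] tangent_space_transition[OF v c]
        linear_add[OF linear_transition_derivative[OF c]] by simp
  qed (simp add: tangent_space_0[OF u] tangent_space_0[OF v])
next
  fix r :: real and u assume u: "u \<in> tangent_space A p"
  show "r *\<^sub>R u \<in> tangent_space A p"
  proof (rule tangent_spaceI)
    fix c c' assume c: "c \<in> A" "c' \<in> A" "p \<in> fst c" "p \<in> fst c'"
    then show "(r *\<^sub>R u) c' = frechet_derivative (snd c' \<circ> chart_inv c) (at (snd c p)) ((r *\<^sub>R u) c)"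
      using tangent_space_transition[OF u c] linear_scale[OF linear_transition_derivative[OF c]]
      by (simp add: scaleR_fun_def)
  qed (simp add: tangent_space_0[OF u] scaleR_fun_def)
qed

text \<open>Conditions imposed on vector fields hold for single tangent vectors because every tangent
  vector is the value of a globally smooth field. Such a field is constant in one chart, cut off by
  a bump function. In any other chart it is smooth on the overlap by the chain rule and vanishes
  on the complement of the compact support; these two open sets cover the chart because
  compact sets are closed in a Hausdorff space.\<close>

lemma tangent_vector_extends:
  assumes "v \<in> tangent_space A p"
  obtains X where "X \<in> vector_fields A" "X p = v"
proof -
  obtain c where c: "c \<in> A" "p \<in> fst c" by (rule atlas_cover)
  note chart = atlas_chart[OF c(1)]
  have "open (chart_image c)" "snd c p \<in> chart_image c"
    using chart c(2) by (auto simp: is_chart_def chart_image_def)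
  then obtain r where r: "r > 0" "cball (snd c p) r \<subseteq> chart_image c"
    by (meson open_contains_cball)
  obtain b :: "'e \<Rightarrow> real" where b: "smooth_on UNIV b" "b (snd c p) = 1"
      "\<And>x. x \<notin> cball (snd c p) r \<Longrightarrow> b x = 0"
    using smooth_bump_exists[OF r(1)] by blast
  define e where "e = v c"
  define X where "X q = (if q \<in> fst c then b (snd c q) *\<^sub>R coord_vec A c q e else 0)" for q
  define K where "K = chart_inv c ` cball (snd c p) r"
  have "continuous_on (cball (snd c p) r) (chart_inv c)"
    using chart r(2) by (meson is_chart_def homeomorphism_def continuous_on_subset)
  then have "closed K"
    unfolding K_def by (intro compact_imp_closed compact_continuous_image) auto
  have X_outside: "X q = 0" if "q \<notin> K" for q
  proof (cases "q \<in> fst c")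
    case True
    then have "snd c q \<notin> cball (snd c p) r"
      using that chart_inv_chart[OF True chart] unfolding K_def by (metis image_eqI)
    then show ?thesis using b(3) by (simp add: X_def)
  qed (simp add: X_def)
  have "X q \<in> tangent_space A q" for q
    using subspace_tangent_space[of q] coord_vec_in_tangent_space[OF c(1), of q]
    by (auto simp: X_def subspace_scale subspace_0)
  moreover have "smooth_on (chart_image c') (\<lambda>x. X (chart_inv c' x) c')" if c': "c' \<in> A" for c'
    unfolding smooth_on_def
  proof
    fix k
    note chart' = atlas_chart[OF c']
    let ?W = "snd c' ` (fst c' \<inter> fst c)" and ?V = "snd c ` (fst c \<inter> fst c')"
    let ?Z = "snd c' ` (fst c' \<inter> - K)"
    let ?\<tau> = "\<lambda>x. snd c (chart_inv c' x)"
    have opens: "open ?W" "open ?V" "open ?Z"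
      using open_overlap[OF c' c(1)] open_overlap[OF c(1) c']
        open_chart_image_subset[OF chart' open_Compl[OF \<open>closed K\<close>]] by simp_all
    have \<tau>: "Ck_on k ?W ?\<tau>" "?\<tau> ` ?W \<subseteq> ?V"
      using Ck_on_transition[OF c' c(1), of k] chart' by (auto simp: comp_def chart_inv_chart)
    \<comment> \<open>The field written as a function of the coordinate y of the chart c.\<close>
    have "Ck_on k ?V (\<lambda>y. frechet_derivative (snd c' \<circ> chart_inv c) (at y) e)"
      using Ck_on_transition[OF c(1) c', of "Suc k"] by simp
    moreover have "Ck_on k ?V b"
      using b(1) by (auto simp: smooth_on_def intro: Ck_on_subset)
    ultimately have "Ck_on k ?V (\<lambda>y. b y *\<^sub>R frechet_derivative (snd c' \<circ> chart_inv c) (at y) e)"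
      by (intro Ck_on_bilinear[OF bounded_bilinear_scaleR opens(2)])
    from Ck_on_compose[OF opens(1,2) \<tau>(2,1) this]
    have "Ck_on k ?W (\<lambda>x. X (chart_inv c' x) c')"
      by (rule Ck_on_cong[OF opens(1), THEN iffD1, rotated])
         (use c' chart' in \<open>auto simp: X_def coord_vec_def chart_inv_chart scaleR_fun_def\<close>)
    moreover have "Ck_on k ?Z (\<lambda>x. X (chart_inv c' x) c')"
      by (rule Ck_on_cong[OF opens(3), THEN iffD1, OF _ Ck_on_const[of _ _ 0]])
         (use chart' X_outside in \<open>auto simp: chart_inv_chart\<close>)
    moreover have "K \<subseteq> fst c"
      using r(2) chart_inv_in[OF _ chart] by (auto simp: K_def)
    then have "chart_image c' = ?W \<union> ?Z" by (auto simp: chart_image_def)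
    ultimately show "Ck_on k (chart_image c') (\<lambda>x. X (chart_inv c' x) c')"
      using Ck_on_Un[OF opens(1,3)] by simp
  qed
  ultimately have "X \<in> vector_fields A" by (simp add: vector_fields_def)
  moreover have "X p = v"
    using c b(2) tangent_vector_eq_coord_vec[OF c assms] by (simp add: X_def e_def)
  ultimately show thesis by (rule that)
qed

text \<open>The composite of a \<open>(0,2)\<close>-tensor and a \<open>(1,1)\<close>-tensor is smooth because its components
  are sums of products of theirs.\<close>

lemma tensor_02_compose_right:
  assumes g: "tensor_02 A g" and T: "tensor_11 A T"
  shows "tensor_02 A (\<lambda>p u v. g p u (T p v))"
  unfolding tensor_02_def
proof (intro conjI allI ballI)
  fix p u assume u: "u \<in> tangent_space A p"
  have T_in: "T p v \<in> tangent_space A p" if "v \<in> tangent_space A p" for v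
    using T that by (auto simp: tensor_11_def)
  show "linear_on_subspace (tangent_space A p) (\<lambda>v. g p u (T p v))"
    using T g u T_in by (simp add: tensor_02_def tensor_11_def linear_on_subspace_def)
  show "linear_on_subspace (tangent_space A p) (\<lambda>v. g p v (T p u))"
    using g T_in[OF u] by (simp add: tensor_02_def)
next
  fix c e e' assume c: "c \<in> A"
  note chart = atlas_chart[OF c]
  then have open_c: "open (chart_image c)" by (simp add: is_chart_def)
  let ?dx = "\<lambda>x. coord_vec A c (chart_inv c x)"
  let ?g = "\<lambda>x u v. g (chart_inv c x) u v" and ?T = "\<lambda>x v. T (chart_inv c x) v"
  have expansion: "?g x (?dx x e) (?T x (?dx x e')) =
      (\<Sum>b\<in>Basis. (?T x (?dx x e') c \<bullet> b) * ?g x (?dx x e) (?dx x b))"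
    if x: "x \<in> chart_image c" for x
  proof -
    let ?V = "tangent_space A (chart_inv c x)" and ?w = "?T x (?dx x e')"
    note q = chart_inv_in[OF x chart]
    have coord: "?dx x b \<in> ?V" for b by (rule coord_vec_in_tangent_space[OF c q])
    then have w: "?w \<in> ?V" using T by (auto simp: tensor_11_def)
    have lin: "linear_on_subspace ?V (?g x (?dx x e))"
      using g coord by (simp add: tensor_02_def)
    have "?w = ?dx x (\<Sum>b\<in>Basis. (?w c \<bullet> b) *\<^sub>R b)"
      using tangent_vector_eq_coord_vec[OF c q w] by (simp add: euclidean_representation)
    also have "\<dots> = (\<Sum>b\<in>Basis. (?w c \<bullet> b) *\<^sub>R ?dx x b)" by (rule coord_vec_sum[OF c q])
    finally have "?g x (?dx x e) ?w = ?g x (?dx x e) (\<Sum>b\<in>Basis. (?w c \<bullet> b) *\<^sub>R ?dx x b)"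
      by (rule arg_cong)
    also have "\<dots> = (\<Sum>b\<in>Basis. (?w c \<bullet> b) *\<^sub>R ?g x (?dx x e) (?dx x b))"
      by (rule linear_on_subspace_sum[OF subspace_tangent_space lin coord])
    finally show ?thesis by simp
  qed
  have "Ck_on k (chart_image c)
      (\<lambda>x. \<Sum>b\<in>Basis. (?T x (?dx x e') c \<bullet> b) * ?g x (?dx x e) (?dx x b))" for k
  proof (intro Ck_on_sum[OF open_c] Ck_on_bilinear[OF bounded_bilinear_mult open_c]
        Ck_on_bilinear[OF bounded_bilinear_inner open_c] Ck_on_const)
    show "Ck_on k (chart_image c) (\<lambda>x. ?T x (?dx x e') c)"
      using T c by (simp add: tensor_11_def smooth_on_def)
    show "Ck_on k (chart_image c) (\<lambda>x. ?g x (?dx x e) (?dx x b))" for b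
      using g c by (simp add: tensor_02_def smooth_on_def)
  qed
  from iffD2[OF Ck_on_cong[OF open_c expansion] this]
  show "smooth_on (chart_image c) (\<lambda>x. ?g x (?dx x e) (?T x (?dx x e')))"
    unfolding smooth_on_def by simp
qed

end

section \<open>The linear algebra of a single tangent space\<close>

text \<open>The carrier \<open>T\<close> is explicit because a tangent space is a subspace of the type of all
  families of components, and the tensors are meaningful on that subspace only.\<close>

locale weak_B_metric_space =
  fixes T :: "'v::real_vector set" and \<phi> Q :: "'v \<Rightarrow> 'v" and \<xi> :: 'v
    and \<eta> :: "'v \<Rightarrow> real" and g :: "'v \<Rightarrow> 'v \<Rightarrow> real"
  assumes subspace: "subspace T"
    and \<phi>_in: "v \<in> T \<Longrightarrow> \<phi> v \<in> T" and \<phi>_linear: "linear_on_subspace T \<phi>"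
    and Q_bij: "bij_betw Q T T" and Q_linear: "linear_on_subspace T Q"
    and \<xi>_in: "\<xi> \<in> T" and \<eta>_linear: "linear_on_subspace T \<eta>"
    and g_linear: "u \<in> T \<Longrightarrow> linear_on_subspace T (g u)"
    and g_sym: "u \<in> T \<Longrightarrow> v \<in> T \<Longrightarrow> g u v = g v u"
    and g_nondeg: "nondegenerate_on T g"
    and \<phi>_\<phi>: "v \<in> T \<Longrightarrow> \<phi> (\<phi> v) = - Q v + \<eta> v *\<^sub>R \<xi>"
    and \<eta>_\<xi>: "\<eta> \<xi> = 1" and Q_\<xi>: "Q \<xi> = \<xi>"
    and \<phi>_ker: "v \<in> T \<Longrightarrow> \<eta> v = 0 \<Longrightarrow> \<eta> (\<phi> v) = 0"
    and compat: "u \<in> T \<Longrightarrow> v \<in> T \<Longrightarrow> g (\<phi> u) (\<phi> v) = - g u (Q v) + \<eta> u * \<eta> v"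
begin

lemmas closed = subspace_add[OF subspace] subspace_scale[OF subspace] subspace_diff[OF subspace]
  subspace_neg[OF subspace] subspace_0[OF subspace] \<phi>_in \<xi>_in

lemma Q_in: "v \<in> T \<Longrightarrow> Q v \<in> T"
  using Q_bij by (auto simp: bij_betw_def)

lemma linear_on_T:
  assumes f: "linear_on_subspace T f"
  shows "u \<in> T \<Longrightarrow> v \<in> T \<Longrightarrow> f (u + v) = f u + f v"
    and "u \<in> T \<Longrightarrow> f (r *\<^sub>R u) = r *\<^sub>R f u"
    and "u \<in> T \<Longrightarrow> v \<in> T \<Longrightarrow> f (u - v) = f u - f v"
    and "u \<in> T \<Longrightarrow> f (- u) = - f u"
    and "f 0 = 0"
proof -
  have add: "f (u + v) = f u + f v" and scale: "f (r *\<^sub>R u) = r *\<^sub>R f u"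
    if "u \<in> T" "v \<in> T" for u v r
    using f that by (auto simp: linear_on_subspace_def)
  then show "u \<in> T \<Longrightarrow> v \<in> T \<Longrightarrow> f (u + v) = f u + f v"
      "u \<in> T \<Longrightarrow> f (r *\<^sub>R u) = r *\<^sub>R f u"
    by blast+
  show neg: "f (- u) = - f u" if "u \<in> T" for u using scale[of u u "-1"] that by simp
  show "f 0 = 0" using scale[of 0 0 0] closed by simp
  show "f (u - v) = f u - f v" if "u \<in> T" "v \<in> T"
    using add[of u "- v"] neg that closed by simp
qed

lemmas \<phi>_lin = linear_on_T[OF \<phi>_linear] and Q_lin = linear_on_T[OF Q_linear]
  and \<eta>_lin = linear_on_T[OF \<eta>_linear] and g_lin = linear_on_T[OF g_linear]

lemma Q_eq_0: "v \<in> T \<Longrightarrow> Q v = 0 \<Longrightarrow> v = 0"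
  using Q_bij Q_lin(5) closed by (auto simp: bij_betw_def inj_on_def)

lemma split_in_ker:
  assumes "v \<in> T"
  shows "v - \<eta> v *\<^sub>R \<xi> \<in> T" "\<eta> (v - \<eta> v *\<^sub>R \<xi>) = 0"
  using assms by (auto simp: closed \<eta>_lin \<eta>_\<xi>)

text \<open>Since \<open>\<phi> (\<phi> \<xi>) = 0\<close>, writing \<open>\<phi> \<xi> = a \<xi> + d\<close> with \<open>d\<close> in the kernel of
  \<open>\<eta>\<close> and applying \<open>\<phi>\<close> and then \<open>\<eta>\<close> gives \<open>a\<^sup>2 = 0\<close>. Hence \<open>\<phi> \<xi>\<close> lies in the kernel,
  where \<open>\<phi> \<circ> \<phi> = - Q\<close> is injective.\<close>

lemma \<phi>_\<xi>: "\<phi> \<xi> = 0"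
proof -
  define a where "a = \<eta> (\<phi> \<xi>)"
  define d where "d = \<phi> \<xi> - a *\<^sub>R \<xi>"
  have d: "d \<in> T" "\<eta> d = 0" using split_in_ker[of "\<phi> \<xi>"] by (auto simp: d_def a_def closed)
  have \<phi>\<xi>: "\<phi> \<xi> = a *\<^sub>R \<xi> + d" by (simp add: d_def)
  have "\<phi> (\<phi> \<xi>) = 0" using \<phi>_\<phi>[OF \<xi>_in] by (simp add: Q_\<xi> \<eta>_\<xi>)
  moreover have "\<phi> (\<phi> \<xi>) = a *\<^sub>R \<phi> \<xi> + \<phi> d"
    by (subst \<phi>\<xi>) (simp add: \<phi>_lin closed d)
  ultimately have "a *\<^sub>R \<phi> \<xi> + \<phi> d = 0" by simp
  then have "\<eta> (a *\<^sub>R \<phi> \<xi> + \<phi> d) = 0" using \<eta>_lin(5) closed by simp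
  then have "a * a = 0" by (simp add: \<eta>_lin closed d \<phi>_ker a_def)
  then have "\<eta> (\<phi> \<xi>) = 0" by (simp add: a_def)
  moreover have "\<phi> (\<phi> (\<phi> \<xi>)) = 0" using \<open>\<phi> (\<phi> \<xi>) = 0\<close> \<phi>_lin(5) closed by simp
  ultimately show ?thesis using \<phi>_\<phi>[of "\<phi> \<xi>"] Q_eq_0 closed by simp
qed

lemma \<eta>_\<phi>:
  assumes "v \<in> T"
  shows "\<eta> (\<phi> v) = 0"
proof -
  have "\<phi> (v - \<eta> v *\<^sub>R \<xi>) = \<phi> v" using assms by (simp add: \<phi>_lin closed \<phi>_\<xi>)
  then show ?thesis using \<phi>_ker[OF split_in_ker[OF assms]] by simp
qed

text \<open>Both sides are \<open>- \<phi>\<^sup>3 v\<close>, with \<open>\<phi>\<^sup>2\<close> expanded either inside or outside the third \<open>\<phi>\<close>.\<close>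

lemma \<phi>_Q:
  assumes "v \<in> T"
  shows "\<phi> (Q v) = Q (\<phi> v)"
proof -
  have "\<phi> (\<phi> (\<phi> v)) = - \<phi> (Q v)"
    using assms by (simp add: \<phi>_\<phi> \<phi>_lin closed Q_in \<phi>_\<xi>)
  moreover have "\<phi> (\<phi> (\<phi> v)) = - Q (\<phi> v)"
    using assms by (simp only: \<phi>_\<phi>[OF \<phi>_in]) (simp add: \<eta>_\<phi>)
  ultimately show ?thesis by simp
qed

lemma \<eta>_eq:
  assumes "v \<in> T"
  shows "\<eta> v = g v \<xi>"
  using compat[OF assms \<xi>_in] g_lin(5)[of "\<phi> v"] assms closed
  by (simp add: \<phi>_\<xi> Q_\<xi> \<eta>_\<xi>)

lemma g_\<xi>_\<xi>: "g \<xi> \<xi> = 1"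
  using \<eta>_eq[OF \<xi>_in] by (simp add: \<eta>_\<xi>)

lemma Q_self_adjoint:
  assumes "u \<in> T" "v \<in> T"
  shows "g (Q u) v = g u (Q v)"
  using compat[OF assms] compat[OF assms(2,1)] g_sym[of "\<phi> u" "\<phi> v"] g_sym[of "Q u" v] assms
  by (simp add: closed Q_in mult.commute)

text \<open>Compatibility applied to \<open>u\<close> and \<open>\<phi> v\<close> gives self-adjointness of \<open>\<phi>\<close> against all
  vectors \<open>Q v\<close>, and \<open>Q\<close> is surjective.\<close>

lemma \<phi>_self_adjoint:
  assumes "u \<in> T" "v \<in> T"
  shows "g (\<phi> u) v = g u (\<phi> v)"
proof -
  obtain w where w: "w \<in> T" "v = Q w" using Q_bij assms(2) by (auto simp: bij_betw_def)
  have "- g (\<phi> u) (Q w) = g (\<phi> u) (\<phi> (\<phi> w))"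
    using assms w \<eta>_eq[of "\<phi> u"] by (simp add: \<phi>_\<phi> g_lin closed Q_in \<eta>_\<phi>)
  also have "\<dots> = - g u (Q (\<phi> w))"
    using compat[of u "\<phi> w"] assms w by (simp add: closed \<eta>_\<phi>)
  finally show ?thesis using w by (simp add: \<phi>_Q)
qed

lemma g_ker_\<xi>: "u \<in> T \<Longrightarrow> \<eta> u = 0 \<Longrightarrow> w \<in> span {\<xi>} \<Longrightarrow> g u w = 0"
  using \<eta>_eq[of u] by (auto simp: span_singleton g_lin closed)

lemma T_eq_ker_plus_span: "T = {u + w |u w. u \<in> {v \<in> T. \<eta> v = 0} \<and> w \<in> span {\<xi>}}" (is "_ = ?S")
proof
  show "T \<subseteq> ?S"
  proof
    fix v assume "v \<in> T"
    then have "v = (v - \<eta> v *\<^sub>R \<xi>) + \<eta> v *\<^sub>R \<xi>" "v - \<eta> v *\<^sub>R \<xi> \<in> {v \<in> T. \<eta> v = 0}"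
        "\<eta> v *\<^sub>R \<xi> \<in> span {\<xi>}"
      using split_in_ker by (auto simp: span_base span_scale)
    then show "v \<in> ?S" by blast
  qed
  show "?S \<subseteq> T" by (auto simp: span_singleton closed)
qed

lemma ker_Int_span: "{v \<in> T. \<eta> v = 0} \<inter> span {\<xi>} = {0}"
  using \<eta>_lin(5) by (auto simp: span_singleton \<eta>_lin \<eta>_\<xi> closed)

text \<open>A vector of the kernel that is orthogonal to the kernel is orthogonal to the whole space,
  being orthogonal to \<open>\<xi>\<close> already.\<close>

lemma orthogonal_to_ker_imp_0:
  assumes u: "u \<in> T" "\<eta> u = 0" and orth: "\<And>v. v \<in> T \<Longrightarrow> \<eta> v = 0 \<Longrightarrow> g u v = 0"
  shows "u = 0"
proof -
  have "g u v = 0" if "v \<in> T" for v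
    using orth[OF split_in_ker[OF that]] u that \<eta>_eq[of u] by (simp add: g_lin closed)
  then show ?thesis using g_nondeg u by (auto simp: nondegenerate_on_def)
qed

lemma nondegenerate_ker: "nondegenerate_on {v \<in> T. \<eta> v = 0} g"
  using orthogonal_to_ker_imp_0 by (auto simp: nondegenerate_on_def)

lemma nondegenerate_span: "nondegenerate_on (span {\<xi>}) g"
  unfolding nondegenerate_on_def
proof (intro ballI impI)
  fix u assume "u \<in> span {\<xi>}" and orth: "\<forall>v\<in>span {\<xi>}. g u v = 0"
  then obtain a where a: "u = a *\<^sub>R \<xi>" by (auto simp: span_singleton)
  have "g u \<xi> = 0" using orth by (auto simp: span_base)
  then have "a = 0" using a g_sym[of u \<xi>] by (simp add: g_lin closed g_\<xi>_\<xi>)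
  then show "u = 0" using a by simp
qed

text \<open>A vector \<open>u\<close> in the radical has \<open>\<phi> u\<close> orthogonal to the kernel of \<open>\<eta>\<close>, so \<open>\<phi> u = 0\<close>
  and then \<open>Q u = - \<phi> (\<phi> u) = 0\<close>.\<close>

lemma nondegenerate_ker_\<phi>: "nondegenerate_on {v \<in> T. \<eta> v = 0} (\<lambda>u v. g u (\<phi> v))"
  unfolding nondegenerate_on_def
proof (intro ballI impI)
  fix u assume "u \<in> {v \<in> T. \<eta> v = 0}" and orth: "\<forall>v\<in>{v \<in> T. \<eta> v = 0}. g u (\<phi> v) = 0"
  then have u: "u \<in> T" "\<eta> u = 0" by auto
  have "\<phi> u = 0"
    using u orth \<phi>_self_adjoint[of u] by (intro orthogonal_to_ker_imp_0) (auto simp: closed \<eta>_\<phi>)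
  then have "\<phi> (\<phi> u) = 0" using \<phi>_lin(5) closed by simp
  then show "u = 0" using \<phi>_\<phi>[OF u(1)] u Q_eq_0 by simp
qed

end

section \<open>Weak almost contact B-metric manifolds\<close>

text \<open>Compatibility of the metric is stated for vector fields; the extension of tangent vectors
  turns it into a statement about each tangent space.\<close>

lemma weak_B_metric_tangent_space:
  assumes "smooth_manifold A" and B: "weak_almost_contact_B_metric A \<phi> Q \<xi> \<eta> g"
  shows "weak_B_metric_space (tangent_space A p) (\<phi> p) (Q p) (\<xi> p) (\<eta> p) (g p)"
proof -
  note defs = weak_almost_contact_B_metric_def weak_almost_contact_def tensor_11_def one_form_def
    vector_fields_def semi_riemannian_metric_def tensor_02_def
  have "g p (\<phi> p u) (\<phi> p v) = - g p u (Q p v) + \<eta> p u * \<eta> p v"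
    if u: "u \<in> tangent_space A p" and v: "v \<in> tangent_space A p" for u v
  proof -
    obtain X where X: "X \<in> vector_fields A" "X p = u"
      using tangent_vector_extends[OF assms(1) u] .
    obtain Y where Y: "Y \<in> vector_fields A" "Y p = v"
      using tangent_vector_extends[OF assms(1) v] .
    have "g p (\<phi> p (X p)) (\<phi> p (Y p)) = - g p (X p) (Q p (Y p)) + \<eta> p (X p) * \<eta> p (Y p)"
      using B X(1) Y(1) by (simp add: weak_almost_contact_B_metric_def)
    then show ?thesis by (simp only: X(2) Y(2))
  qed
  moreover have "\<eta> p (\<phi> p v) = 0" if "v \<in> tangent_space A p" "\<eta> p v = 0" for v
  proof -
    have "\<phi> p ` contact_distribution A \<eta> p \<subseteq> contact_distribution A \<eta> p"
      using B by (simp add: weak_almost_contact_B_metric_def weak_almost_contact_def)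
    then show ?thesis using that by (auto simp: contact_distribution_def)
  qed
  moreover have "\<phi> p v \<in> tangent_space A p" if "v \<in> tangent_space A p" for v
  proof -
    have "\<phi> p ` tangent_space A p \<subseteq> tangent_space A p" using B by (simp add: defs)
    then show ?thesis using that by blast
  qed
  moreover have "g p u v = g p v u" if "u \<in> tangent_space A p" "v \<in> tangent_space A p" for u v
    using B that by (simp add: defs symmetric_on_def)
  ultimately show ?thesis
    using B subspace_tangent_space[OF assms(1)]
    by (intro weak_B_metric_space.intro) (simp_all add: defs)
qed

text \<open>A parallel metric makes the derivative of the squared length of a field twice the product
  of the field with its covariant derivative.\<close>

lemma levi_civita_constant_length:
  assumes "levi_civita_connection A g nabla" "semi_riemannian_metric A g"
    and X: "X \<in> vector_fields A" and Y: "Y \<in> vector_fields A"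
    and const: "\<And>q. g q (Y q) (Y q) = r"
  shows "g p (nabla X Y p) (Y p) = 0"
proof -
  have "nabla X Y \<in> vector_fields A"
    using assms(1) X Y by (simp add: levi_civita_connection_def affine_connection_def)
  then have "nabla X Y p \<in> tangent_space A p" "Y p \<in> tangent_space A p"
    using Y by (simp_all add: vector_fields_def)
  then have "g p (Y p) (nabla X Y p) = g p (nabla X Y p) (Y p)"
    using assms(2) by (simp add: semi_riemannian_metric_def symmetric_on_def)
  moreover have "vf_apply A X (\<lambda>q. g q (Y q) (Y q)) p =
      g p (nabla X Y p) (Y p) + g p (Y p) (nabla X Y p)"
    using assms(1) X Y by (simp add: levi_civita_connection_def)
  moreover have "vf_apply A X (\<lambda>q. g q (Y q) (Y q)) p = 0"
    by (simp add: const vf_apply_def comp_def frechet_derivative_const)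
  ultimately show ?thesis by simp
qed

theorem proposition16:
  fixes A :: "('a::{t2_space,second_countable_topology}, 'e::euclidean_space) chart set"
    and n :: nat
    and \<phi> Q :: "'a \<Rightarrow> ('a, 'e) tvec \<Rightarrow> ('a, 'e) tvec"
    and \<xi> :: "('a, 'e) vfield"
    and \<eta> :: "'a \<Rightarrow> ('a, 'e) tvec \<Rightarrow> real"
    and g G :: "'a \<Rightarrow> ('a, 'e) tvec \<Rightarrow> ('a, 'e) tvec \<Rightarrow> real"
    and D :: "'a \<Rightarrow> ('a, 'e) tvec set"
    and nabla :: "('a, 'e) vfield \<Rightarrow> ('a, 'e) vfield \<Rightarrow> ('a, 'e) vfield"
  assumes "n \<ge> 1" and "DIM('e) = 2 * n + 1"
    and "smooth_manifold A"
    and "weak_almost_contact_B_metric A \<phi> Q \<xi> \<eta> g"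
    and "levi_civita_connection A g nabla"
    and D_def: "D = contact_distribution A \<eta>"
    and G_def: "G = (\<lambda>p u v. g p u (\<phi> p v))"
  shows
    "(\<forall>p. \<forall>v\<in>tangent_space A p. \<eta> p v = g p v (\<xi> p))
     \<and>
     (\<forall>p. tangent_space A p = {u + w |u w. u \<in> D p \<and> w \<in> span {\<xi> p}} \<and>
          D p \<inter> span {\<xi> p} = {0} \<and>
          (\<forall>u\<in>D p. \<forall>w\<in>span {\<xi> p}. g p u w = 0) \<and>
          nondegenerate_on (D p) (g p) \<and>
          nondegenerate_on (span {\<xi> p}) (g p))
     \<and>
     (\<forall>X\<in>vector_fields A.
          (\<forall>p. g p (nabla X \<xi> p) (\<xi> p) = 0) \<and> nabla X \<xi> \<in> smooth_sections A D)
     \<and>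
     (\<forall>X\<in>vector_fields A. \<forall>Y\<in>vector_fields A. \<forall>p.
          g p (\<phi> p (X p)) (Y p) = g p (X p) (\<phi> p (Y p)) \<and>
          g p (Q p (X p)) (Y p) = g p (X p) (Q p (Y p)))
     \<and>
     (tensor_02 A G \<and>
      (\<forall>p. symmetric_on (tangent_space A p) (G p)) \<and>
      (\<forall>p. nondegenerate_on (D p) (G p)))
     \<and>
     (\<forall>p. \<forall>v\<in>tangent_space A p. \<phi> p (Q p v) = Q p (\<phi> p v))"
proof -
  note pointwise = weak_B_metric_tangent_space[OF assms(3,4)]
  have D: "D p = {v \<in> tangent_space A p. \<eta> p v = 0}" for p
    by (simp add: D_def contact_distribution_def)
  have tensors: "tensor_11 A \<phi>" "\<xi> \<in> vector_fields A" "semi_riemannian_metric A g" "tensor_02 A g"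
    using assms(4)
    by (simp_all add: weak_almost_contact_B_metric_def weak_almost_contact_def
        semi_riemannian_metric_def)
  have field: "X p \<in> tangent_space A p" if "X \<in> vector_fields A" for X p
    using that by (simp add: vector_fields_def)
  have \<eta>: "\<eta> p v = g p v (\<xi> p)" if "v \<in> tangent_space A p" for p v
    using weak_B_metric_space.\<eta>_eq[OF pointwise that] .
  have splitting: "\<forall>p. tangent_space A p = {u + w |u w. u \<in> D p \<and> w \<in> span {\<xi> p}} \<and>
      D p \<inter> span {\<xi> p} = {0} \<and> (\<forall>u\<in>D p. \<forall>w\<in>span {\<xi> p}. g p u w = 0) \<and>
      nondegenerate_on (D p) (g p) \<and> nondegenerate_on (span {\<xi> p}) (g p)"
  proof (intro allI conjI)
    fix p
    show "tangent_space A p = {u + w |u w. u \<in> D p \<and> w \<in> span {\<xi> p}}"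
      unfolding D by (rule weak_B_metric_space.T_eq_ker_plus_span[OF pointwise])
    show "D p \<inter> span {\<xi> p} = {0}"
      unfolding D by (rule weak_B_metric_space.ker_Int_span[OF pointwise])
    show "\<forall>u\<in>D p. \<forall>w\<in>span {\<xi> p}. g p u w = 0"
      using weak_B_metric_space.g_ker_\<xi>[OF pointwise] by (simp add: D)
    show "nondegenerate_on (D p) (g p)"
      unfolding D by (rule weak_B_metric_space.nondegenerate_ker[OF pointwise])
    show "nondegenerate_on (span {\<xi> p}) (g p)"
      by (rule weak_B_metric_space.nondegenerate_span[OF pointwise])
  qed
  have nabla_\<xi>: "\<forall>X\<in>vector_fields A.
      (\<forall>p. g p (nabla X \<xi> p) (\<xi> p) = 0) \<and> nabla X \<xi> \<in> smooth_sections A D"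
  proof
    fix X assume X: "X \<in> vector_fields A"
    have orth: "g p (nabla X \<xi> p) (\<xi> p) = 0" for p
      using weak_B_metric_space.g_\<xi>_\<xi>[OF pointwise]
      by (rule levi_civita_constant_length[OF assms(5) tensors(3) X tensors(2)])
    have smooth: "nabla X \<xi> \<in> vector_fields A"
      using assms(5) X tensors(2) by (simp add: levi_civita_connection_def affine_connection_def)
    moreover have "nabla X \<xi> p \<in> D p" for p
      using field[OF smooth, of p] \<eta> orth by (simp add: D)
    ultimately show "(\<forall>p. g p (nabla X \<xi> p) (\<xi> p) = 0) \<and> nabla X \<xi> \<in> smooth_sections A D"
      using orth by (simp add: smooth_sections_def)
  qed
  have self_adjoint: "g p (\<phi> p u) v = g p u (\<phi> p v)" "g p (Q p u) v = g p u (Q p v)"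
    if "u \<in> tangent_space A p" "v \<in> tangent_space A p" for p u v
    using weak_B_metric_space.\<phi>_self_adjoint[OF pointwise that]
      weak_B_metric_space.Q_self_adjoint[OF pointwise that] by auto
  have tensor_G: "tensor_02 A G"
    unfolding G_def by (rule tensor_02_compose_right[OF assms(3) tensors(4,1)])
  have sym_G: "symmetric_on (tangent_space A p) (G p)" for p
    unfolding symmetric_on_def G_def
  proof (intro ballI)
    fix u v assume uv: "u \<in> tangent_space A p" "v \<in> tangent_space A p"
    then show "g p u (\<phi> p v) = g p v (\<phi> p u)"
      using self_adjoint(1)[OF uv] weak_B_metric_space.g_sym[OF pointwise, of "\<phi> p u" p v]
        weak_B_metric_space.\<phi>_in[OF pointwise uv(1)] by simp
  qed
  have nondeg_G: "nondegenerate_on (D p) (G p)" for p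
    unfolding D G_def by (rule weak_B_metric_space.nondegenerate_ker_\<phi>[OF pointwise])
  show ?thesis
  proof (intro conjI)
    show "\<forall>p. \<forall>v\<in>tangent_space A p. \<eta> p v = g p v (\<xi> p)"
      using \<eta> by blast
    show "\<forall>X\<in>vector_fields A. \<forall>Y\<in>vector_fields A. \<forall>p.
        g p (\<phi> p (X p)) (Y p) = g p (X p) (\<phi> p (Y p)) \<and>
        g p (Q p (X p)) (Y p) = g p (X p) (Q p (Y p))"
      by (intro ballI allI conjI self_adjoint field)
    show "\<forall>p. \<forall>v\<in>tangent_space A p. \<phi> p (Q p v) = Q p (\<phi> p v)"
      using weak_B_metric_space.\<phi>_Q[OF pointwise] by blast
  qed (fact splitting nabla_\<xi> tensor_G allI[OF sym_G] allI[OF nondeg_G])+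
qed

end
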